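(* There exists a $(4,5;5)$-babi-graph on $28$ vertices.
   Context: Graphs are finite and simple. The girth of a graph is the length of its shortest cycle. For integers $1\leq r\leq s$ and $g\geq 3$, an $(r,s;g)$-balanced biregular graph (for short, $(r,s;g)$-babi-graph) is a graph of girth $g$ whose set of vertex degrees equals $\{r,s\}$ and in which the number of vertices of degree $r$ equals the number of vertices of degree $s$. *)

theory Defs
  imports Graph_Theory.Pair_Digraph "HOL-Library.Extended_Nat"
begin

text \<open>
  Finite simple graphs are the library's \<open>pair_graph\<close>: finite, loop-free, symmetric, without
  parallel arcs. An undirected edge is a pair of opposite arcs, so the degree of a vertex is its
  \<open>out_degree\<close>.
\<close>

definition degree_set :: "'a pair_pre_digraph \<Rightarrow> nat set" where
  "degree_set G = out_degree G ` pverts G"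

text \<open>
  In a symmetric digraph the library's \<open>cycle\<close> also admits the closed walk \<open>u, v, u\<close> along one
  undirected edge, which is not a cycle of the undirected graph; the bound on the length excludes
  exactly these. The girth of an acyclic graph is \<open>\<infinity>\<close>, the infimum of the empty set.
\<close>

definition undirected_cycle :: "'a pair_pre_digraph \<Rightarrow> ('a \<times> 'a) awalk \<Rightarrow> bool" where
  "undirected_cycle G p \<longleftrightarrow> pre_digraph.cycle G p \<and> 3 \<le> length p"

definition girth :: "'a pair_pre_digraph \<Rightarrow> enat" where
  "girth G = (INF p \<in> {p. undirected_cycle G p}. enat (length p))"

definition babi_graph :: "nat \<Rightarrow> nat \<Rightarrow> nat \<Rightarrow> 'a pair_pre_digraph \<Rightarrow> bool" where
  "babi_graph r s g G \<longleftrightarrow>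
     1 \<le> r \<and> r \<le> s \<and> 3 \<le> g \<and>
     pair_graph G \<and>
     girth G = enat g \<and>
     degree_set G = {r, s} \<and>
     card {v \<in> pverts G. out_degree G v = r} = card {v \<in> pverts G. out_degree G v = s}"

end

theory Submission
  imports Defs "HOL-Number_Theory.Cong"
begin

text \<open>
  The graph is built on the cyclic group of order 14. The set \<open>{0, 1, 4, 6}\<close> is a perfect Golomb
  ruler: its twelve differences \<open>\<plusminus>1, \<dots>, \<plusminus>6\<close> are distinct modulo 14 and leave out only the
  nonzero residue 7, the element of order two. Take 14 points and 14 blocks, both indexed by
  residues, and let the point \<open>x\<close> lie on the blocks \<open>x + d\<close> for \<open>d\<close> in the ruler. Every point is on
  four blocks and every block has four points, and as the differences are distinct, two points
  share at most one block: the incidence graph is 4-regular and has no cycle of length at most 4.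

  It remains to raise the degree of every point to five without creating a triangle or a
  quadrilateral. The missing difference makes this possible: \<open>x\<close> and \<open>x + 7\<close> never lie on a common
  block, so joining all these pairs creates no triangle. The new edges form a perfect matching on
  the points, so in a quadrilateral through a new edge \<open>x, x + 7\<close> the other neighbours of \<open>x\<close> and
  \<open>x + 7\<close> would be two adjacent blocks; but blocks are pairwise nonadjacent. A new edge and a path
  of length four between its ends in the incidence graph form a pentagon.
\<close>

section \<open>Cycles of length at least five\<close>

lemma girth_eqI:
  assumes "undirected_cycle G c" "length c = g"
    and "\<And>p. undirected_cycle G p \<Longrightarrow> g \<le> length p"
  shows "girth G = enat g"
  unfolding girth_def
proof (rule antisym)
  show "(INF p \<in> {p. undirected_cycle G p}. enat (length p)) \<le> enat g"
    using assms(1,2) by (auto intro: INF_lower2)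
  show "enat g \<le> (INF p \<in> {p. undirected_cycle G p}. enat (length p))"
    using assms(3) by (auto intro: INF_greatest)
qed

text \<open>
  A closed walk of length four may retrace its edges, as in \<open>u, a, u, b\<close>; it does so exactly when
  opposite vertices coincide, and the distinctness of the vertices of a cycle rules this out.
\<close>

lemma length_undirected_cycle_ge_5:
  assumes no_triangle: "\<And>u v w. \<lbrakk>(u, v) \<in> parcs G; (v, w) \<in> parcs G; (w, u) \<in> parcs G\<rbrakk> \<Longrightarrow> False"
    and no_quadrilateral: "\<And>u v a b. \<lbrakk>(u, a) \<in> parcs G; (a, v) \<in> parcs G; (v, b) \<in> parcs G;
      (b, u) \<in> parcs G\<rbrakk> \<Longrightarrow> u = v \<or> a = b"
    and cyc: "undirected_cycle G p"
  shows "5 \<le> length p"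
proof (rule ccontr)
  from cyc obtain u where len: "3 \<le> length p" and arcs: "set p \<subseteq> parcs G" and closed: "pcas u p u"
    and dist: "distinct (tl (pawalk_verts u p))"
    by (auto simp: undirected_cycle_def pre_digraph.cycle_def pre_digraph.awalk_def
        cas_with_proj_eq awalk_verts_with_proj_eq)
  assume "\<not> 5 \<le> length p"
  with len consider "length p = 3" | "length p = 4" by linarith
  then show False
  proof cases
    case 1
    then obtain e1 e2 e3 where "p = [e1, e2, e3]"
      by (auto simp: numeral_eq_Suc length_Suc_conv)
    with arcs closed no_triangle show False
      by (cases e1; cases e2; cases e3) auto
  next
    case 2
    then obtain e1 e2 e3 e4 where "p = [e1, e2, e3, e4]"
      by (auto simp: numeral_eq_Suc length_Suc_conv)
    with arcs closed dist no_quadrilateral show False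
      by (cases e1; cases e2; cases e3; cases e4) fastforce
  qed
qed

section \<open>A perfect Golomb ruler modulo 14\<close>

definition ruler :: "nat set" where
  "ruler = {0, 1, 4, 6}"

text \<open>
  Distinctness of the differences, written with sums: \<open>a - c = d - b\<close> must be the zero
  difference or the same difference of the same two marks. Sums avoid truncated subtraction.
\<close>

lemma ruler_sidon:
  assumes "a \<in> ruler" "b \<in> ruler" "c \<in> ruler" "d \<in> ruler" "[a + b = c + d] (mod 14)"
  shows "a = c \<or> a = d"
  using assms by (auto simp: ruler_def cong_def)

lemma seven_not_ruler_difference:
  assumes "a \<in> ruler" "b \<in> ruler"
  shows "\<not> [a = b + 7] (mod 14)"
  using assms by (auto simp: ruler_def cong_def)

section \<open>Points and blocks\<close>

text \<open>
  The points are the numbers below 14, and the number \<open>14 + y\<close> stands for the block \<open>y\<close>. Thus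
  the subtraction below does not truncate, and the offset 14 vanishes modulo 14.
\<close>

definition incident :: "nat \<Rightarrow> nat \<Rightarrow> bool" where
  "incident x b \<longleftrightarrow> x < 14 \<and> b \<in> {14..<28} \<and> (b - x) mod 14 \<in> ruler"

definition antipodal :: "nat \<Rightarrow> nat \<Rightarrow> bool" where
  "antipodal x y \<longleftrightarrow> y < 7 \<and> x = y + 7 \<or> x < 7 \<and> y = x + 7"

definition adjacent :: "nat \<Rightarrow> nat \<Rightarrow> bool" where
  "adjacent u v \<longleftrightarrow> antipodal u v \<or> incident u v \<or> incident v u"

definition ruler_graph :: "nat pair_pre_digraph" where
  "ruler_graph = \<lparr>pverts = {..<28}, parcs = {(u, v). adjacent u v}\<rparr>"

lemma incident_ranges: "incident x b \<Longrightarrow> x < 14 \<and> 14 \<le> b \<and> b < 28"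
  by (simp add: incident_def)

lemma antipodal_range: "antipodal x y \<Longrightarrow> x < 14 \<and> y < 14"
  by (auto simp: antipodal_def)

lemma antipodal_commute: "antipodal x y \<longleftrightarrow> antipodal y x"
  by (auto simp: antipodal_def)

lemma antipode_unique: "antipodal x y \<Longrightarrow> antipodal x z \<Longrightarrow> y = z"
  by (auto simp: antipodal_def)

lemma adjacent_sym: "adjacent u v \<Longrightarrow> adjacent v u"
  by (auto simp: adjacent_def antipodal_commute)

lemma eq_if_close_mod_eq:
  fixes m n k :: nat
  assumes "m mod k = n mod k" "m < n + k" "n < m + k"
  shows "m = n"
  using assms
proof (induction m n rule: linorder_wlog)
  case (le m n)
  then have "k dvd n - m"
    by (metis mod_eq_dvd_iff_nat)
  moreover have "n - m < k"
    using le by linarith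
  ultimately have "n - m = 0"
    using nat_dvd_not_less by blast
  with le show ?case by simp
qed simp

text \<open>
  If \<open>x\<close> and \<open>y\<close> both lie on \<open>b\<close> and \<open>c\<close>, then \<open>(b - x) + (c - y) = (b - y) + (c - x)\<close> equates two
  sums of marks of the ruler, so \<open>b - x\<close> agrees modulo 14 with \<open>b - y\<close> or with \<open>c - x\<close>.
\<close>

lemma common_block_unique:
  assumes "incident x b" "incident x c" "incident y b" "incident y c"
  shows "x = y \<or> b = c"
proof -
  have ranges: "x < 14" "y < 14" "14 \<le> b" "b < 28" "14 \<le> c" "c < 28"
    using assms by (auto dest: incident_ranges)
  have "(b - x) + (c - y) = (b - y) + (c - x)"
    using ranges by linarith
  then have "[(b - x) mod 14 + (c - y) mod 14 = (b - y) mod 14 + (c - x) mod 14] (mod 14)"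
    by (simp add: cong_def mod_simps)
  then have "(b - x) mod 14 = (b - y) mod 14 \<or> (b - x) mod 14 = (c - x) mod 14"
    using assms by (intro ruler_sidon) (auto simp: incident_def)
  then have "b - x = b - y \<or> b - x = c - x"
    using ranges by (elim disjE) (auto dest!: eq_if_close_mod_eq)
  then show ?thesis
    using ranges by linarith
qed

lemma antipodal_no_common_block:
  assumes "antipodal x y" "incident x b" "incident y b"
  shows False
proof -
  have "b - y = b - x + 7 \<or> b - x = b - y + 7"
    using assms by (auto simp: antipodal_def dest: incident_ranges)
  then have "[(b - y) mod 14 = (b - x) mod 14 + 7] (mod 14)
    \<or> [(b - x) mod 14 = (b - y) mod 14 + 7] (mod 14)"
    by (auto simp: cong_def mod_simps)
  with assms show False
    using seven_not_ruler_difference[of "(b - x) mod 14" "(b - y) mod 14"]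
      seven_not_ruler_difference[of "(b - y) mod 14" "(b - x) mod 14"]
    by (auto simp: incident_def)
qed

lemma adjacent_iff:
  shows "x < 14 \<Longrightarrow> y < 14 \<Longrightarrow> adjacent x y \<longleftrightarrow> antipodal x y"
    and "x < 14 \<Longrightarrow> \<not> b < 14 \<Longrightarrow> adjacent x b \<longleftrightarrow> incident x b"
    and "x < 14 \<Longrightarrow> \<not> b < 14 \<Longrightarrow> adjacent b x \<longleftrightarrow> incident x b"
    and "\<not> b < 14 \<Longrightarrow> \<not> c < 14 \<Longrightarrow> \<not> adjacent b c"
  by (auto simp: adjacent_def dest: incident_ranges antipodal_range)

text \<open>
  Blocks are pairwise nonadjacent, so a triangle contains two points and hence an antipodal pair;
  its third vertex can be neither a common block nor a common antipode.
\<close>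

lemma no_triangle:
  assumes "adjacent u v" "adjacent v w" "adjacent w u"
  shows False
proof -
  have "\<not> (antipodal u v \<and> antipodal v w \<and> antipodal w u)"
    by (auto simp: antipodal_def)
  with assms antipodal_no_common_block[of u v w] antipodal_no_common_block[of v w u]
    antipodal_no_common_block[of w u v]
  show False
    by (cases "u < 14"; cases "v < 14"; cases "w < 14") (auto simp: adjacent_iff)
qed

text \<open>
  If the vertices are alternately points and blocks, two points share two blocks. Otherwise there
  is an antipodal edge; as a point has only one antipode, the other two vertices would be adjacent
  blocks.
\<close>

lemma no_quadrilateral:
  assumes "adjacent u a" "adjacent a v" "adjacent v b" "adjacent b u"
  shows "u = v \<or> a = b"
  using assms common_block_unique[of u a b v] common_block_unique[of a u v b]
    antipode_unique[of u a b] antipode_unique[of v a b]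
    antipode_unique[of a u v] antipode_unique[of b u v]
  by (cases "u < 14"; cases "v < 14"; cases "a < 14"; cases "b < 14")
    (auto simp: adjacent_iff antipodal_commute)

section \<open>Degrees and girth\<close>

lemma pair_graph_ruler_graph: "pair_graph ruler_graph"
proof unfold_locales
  have "parcs ruler_graph \<subseteq> {..<28} \<times> {..<28}"
    by (auto simp: ruler_graph_def adjacent_def dest: incident_ranges antipodal_range)
  then show "finite (parcs ruler_graph)"
    by (rule finite_subset) simp
  show "fst e \<in> pverts ruler_graph" "snd e \<in> pverts ruler_graph" if "e \<in> parcs ruler_graph" for e
    using that
    by (auto simp: ruler_graph_def adjacent_def dest: incident_ranges antipodal_range)
  show "fst e \<noteq> snd e" if "e \<in> parcs ruler_graph" for e
    using that
    by (auto simp: ruler_graph_def adjacent_def antipodal_def dest: incident_ranges)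
  show "symmetric ruler_graph"
    by (auto simp: symmetric_def ruler_graph_def intro: symI adjacent_sym)
qed (simp add: ruler_graph_def)

lemma out_degree_ruler_graph: "out_degree ruler_graph u = card {v. adjacent u v}"
proof -
  have "out_arcs ruler_graph u = Pair u ` {v. adjacent u v}"
    by (auto simp: out_arcs_def ruler_graph_def)
  then show ?thesis
    by (simp add: out_degree_def card_image inj_on_def)
qed

text \<open>
  A point and a block determine their difference \<open>d\<close>, and \<open>d\<close> with one of them determines the
  other. The next two inversion formulas give both the neighbourhoods and the injectivity that
  their cardinalities need.
\<close>

lemma block_minus_point:
  fixes x d :: nat
  assumes "x < 14" "d < 14"
  shows "(14 + (x + d) mod 14 - x) mod 14 = d"
  using assms by (cases "x + d < 14") (simp_all add: le_mod_geq)

lemma block_minus_mark: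
  fixes b d :: nat
  assumes "14 \<le> b" "b < 28" "d < 14"
  shows "(b - (b - d) mod 14) mod 14 = d"
  using assms by (cases "b - d < 14") (simp_all add: le_mod_geq)

lemma ruler_less: "d \<in> ruler \<Longrightarrow> d < 14"
  by (auto simp: ruler_def)

lemma neighbours_of_point:
  assumes "x < 14"
  shows "{v. adjacent x v} = insert ((x + 7) mod 14) ((\<lambda>d. 14 + (x + d) mod 14) ` ruler)"
proof -
  have "{b. incident x b} = (\<lambda>d. 14 + (x + d) mod 14) ` ruler"
  proof (intro equalityI subsetI)
    fix b assume "b \<in> {b. incident x b}"
    then have inc: "incident x b" by simp
    then have "x < 14" "14 \<le> b" "b < 28"
      by (auto dest: incident_ranges)
    then have "b = 14 + (x + (b - x) mod 14) mod 14"
      by (simp add: mod_simps le_mod_geq)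
    with inc show "b \<in> (\<lambda>d. 14 + (x + d) mod 14) ` ruler"
      by (auto simp: incident_def)
  next
    fix b assume "b \<in> (\<lambda>d. 14 + (x + d) mod 14) ` ruler"
    with assms show "b \<in> {b. incident x b}"
      by (auto simp: incident_def block_minus_point ruler_less)
  qed
  moreover have "antipodal x v \<longleftrightarrow> v = (x + 7) mod 14" for v
    using assms by (cases "x < 7") (auto simp: antipodal_def le_mod_geq)
  ultimately show ?thesis
    using assms by (auto simp: adjacent_def dest: incident_ranges)
qed

lemma neighbours_of_block:
  assumes "14 \<le> b" "b < 28"
  shows "{v. adjacent b v} = (\<lambda>d. (b - d) mod 14) ` ruler"
proof (intro equalityI subsetI)
  fix x assume "x \<in> {v. adjacent b v}"
  then have inc: "incident x b"
    using assms by (auto simp: adjacent_def dest: incident_ranges antipodal_range)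
  then have "x = (b - (b - x) mod 14) mod 14"
    using incident_ranges[OF inc] by (simp add: block_minus_mark)
  with inc show "x \<in> (\<lambda>d. (b - d) mod 14) ` ruler"
    by (auto simp: incident_def)
next
  fix x assume "x \<in> (\<lambda>d. (b - d) mod 14) ` ruler"
  with assms show "x \<in> {v. adjacent b v}"
    by (auto simp: incident_def adjacent_def block_minus_mark ruler_less)
qed

lemma out_degree_point:
  assumes "x < 14"
  shows "out_degree ruler_graph x = 5"
proof -
  have "inj_on (\<lambda>d. 14 + (x + d) mod 14) ruler"
    using assms
    by (intro inj_on_inverseI[where g = "\<lambda>b. (b - x) mod 14"])
      (auto simp: block_minus_point ruler_less)
  then have "card ((\<lambda>d. 14 + (x + d) mod 14) ` ruler) = 4"
    by (simp add: card_image ruler_def)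
  moreover have "(x + 7) mod 14 \<notin> (\<lambda>d. 14 + (x + d) mod 14) ` ruler"
  proof
    assume "(x + 7) mod 14 \<in> (\<lambda>d. 14 + (x + d) mod 14) ` ruler"
    then have "14 \<le> (x + 7) mod 14" by auto
    moreover have "(x + 7) mod 14 < 14" by simp
    ultimately show False by linarith
  qed
  moreover have "finite ruler" by (simp add: ruler_def)
  ultimately show ?thesis
    using assms by (simp add: out_degree_ruler_graph neighbours_of_point)
qed

lemma out_degree_block:
  assumes "14 \<le> b" "b < 28"
  shows "out_degree ruler_graph b = 4"
proof -
  have "inj_on (\<lambda>d. (b - d) mod 14) ruler"
    using assms
    by (intro inj_on_inverseI[where g = "\<lambda>x. (b - x) mod 14"] block_minus_mark ruler_less)
  then have "card ((\<lambda>d. (b - d) mod 14) ` ruler) = 4"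
    by (simp add: card_image ruler_def)
  then show ?thesis
    using assms by (simp add: out_degree_ruler_graph neighbours_of_block)
qed

lemma girth_ruler_graph: "girth ruler_graph = enat 5"
proof (rule girth_eqI)
  \<comment> \<open>The new edge between the points 0 and 7, closed up through the block 21, which contains the
    points 7 and 1, and the block 15, which contains 1 and 0.\<close>
  let ?c = "[(0, 7), (7, 21), (21, 1), (1, 15), (15, 0)]"
  have "pre_digraph.awalk ruler_graph 0 ?c 0"
    by (simp add: pre_digraph.awalk_def cas_with_proj_eq ruler_graph_def adjacent_def
        antipodal_def incident_def ruler_def)
  moreover have "distinct (tl (pawalk_verts (0 :: nat) ?c))"
    by simp
  ultimately show "undirected_cycle ruler_graph ?c"
    by (auto simp: undirected_cycle_def pre_digraph.cycle_def awalk_verts_with_proj_eq)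
  show "length ?c = 5" by simp
  show "5 \<le> length p" if "undirected_cycle ruler_graph p" for p
    using _ _ that
    by (rule length_undirected_cycle_ge_5)
      (auto simp: ruler_graph_def dest: no_triangle no_quadrilateral)
qed

theorem theorem5p4:
  shows "\<exists>G :: nat pair_pre_digraph. babi_graph 4 5 5 G \<and> card (pverts G) = 28"
proof -
  have verts: "pverts ruler_graph = {..<14} \<union> {14..<28}"
    by (auto simp: ruler_graph_def)
  have deg: "degree_set ruler_graph = {4, 5}"
  proof -
    have "out_degree ruler_graph ` {..<14 :: nat} = (\<lambda>_. 5) ` {..<14 :: nat}"
      by (rule image_cong) (simp_all add: out_degree_point)
    moreover have "out_degree ruler_graph ` {14..<28 :: nat} = (\<lambda>_. 4) ` {14..<28 :: nat}"
      by (rule image_cong) (simp_all add: out_degree_block)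
    ultimately show ?thesis
      by (simp add: degree_set_def verts image_Un image_constant_conv lessThan_empty_iff
          insert_commute)
  qed
  have "{v \<in> pverts ruler_graph. out_degree ruler_graph v = 4} = {14..<28}"
    "{v \<in> pverts ruler_graph. out_degree ruler_graph v = 5} = {..<14}"
    by (auto simp: verts out_degree_point out_degree_block)
  then have "babi_graph 4 5 5 ruler_graph"
    by (simp add: babi_graph_def pair_graph_ruler_graph girth_ruler_graph deg)
  moreover have "card (pverts ruler_graph) = 28"
    by (simp add: ruler_graph_def)
  ultimately show ?thesis by blast
qed

end
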